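(* The triangle map $T$ is topologically strongly mixing on $\Delta$: for any nonempty open sets $U,V\subseteq\Delta$ there is a positive integer $N$ such that $T^k(U)\cap V\neq\emptyset$ for all $k\ge N$.
   Context: Let $\Delta=\{(x,y)\in\mathbb{R}^2: 1\ge x\ge y>0\}$ with the subspace topology from $\mathbb{R}^2$. For each integer $k\ge 0$ let $\Delta_k=\{(x,y)\in\Delta: 1-x-ky\ge 0> 1-x-(k+1)y\}$; these partition $\Delta$. The triangle map $T:\Delta\to\Delta\cup\{(t,0):0\le t\le1\}$ is $T(\alpha,\beta)=\left(\frac{\beta}{\alpha},\frac{1-\alpha-k\beta}{\alpha}\right)$ for $(\alpha,\beta)\in\Delta_k$; $T^k(U)$ denotes the set of points $T^k(p)$ for $p\in U$ such that $T^j(p)\in\Delta$ for all $j<k$. *)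

theory Defs
  imports "HOL-Analysis.Analysis"
begin

definition triangle_domain :: "(real \<times> real) set" where
  "triangle_domain = {(x, y). 1 \<ge> x \<and> x \<ge> y \<and> y > 0}"

definition triangle_piece :: "nat \<Rightarrow> (real \<times> real) set" where
  "triangle_piece k =
     {(x, y) \<in> triangle_domain. 1 - x - real k * y \<ge> 0 \<and> 0 > 1 - x - real (k + 1) * y}"

(* Only the values on triangle_domain are meaningful; see triangle_map_eq. *)
definition triangle_map :: "real \<times> real \<Rightarrow> real \<times> real" where
  "triangle_map p =
     (let k = (THE k. p \<in> triangle_piece k); a = fst p; b = snd p
      in (b / a, (1 - a - real k * b) / a))"

(* T^k(U) for the partial map T: only points whose first k iterates
   (those of index 0, ..., k - 1) stay in triangle_domain contribute, so the
   values of triangle_map outside triangle_domain never matter. *)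
definition triangle_iterate_image :: "nat \<Rightarrow> (real \<times> real) set \<Rightarrow> (real \<times> real) set" where
  "triangle_iterate_image k U =
     {(triangle_map ^^ k) p | p. p \<in> U \<and> (\<forall>j<k. (triangle_map ^^ j) p \<in> triangle_domain)}"

lemma triangle_piece_ex1:
  assumes "p \<in> triangle_domain"
  shows "\<exists>!k. p \<in> triangle_piece k"
proof -
  obtain x y where p: "p = (x, y)" by (cases p)
  from assms have xy: "x \<le> 1" "y \<le> x" "y > 0" by (auto simp: p triangle_domain_def)
  have iff: "p \<in> triangle_piece k \<longleftrightarrow> \<lfloor>(1 - x) / y\<rfloor> = int k" for k
  proof -
    have "p \<in> triangle_piece k \<longleftrightarrow> real k * y \<le> 1 - x \<and> 1 - x < (real k + 1) * y"
      using assms by (auto simp: p triangle_piece_def algebra_simps)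
    also have "\<dots> \<longleftrightarrow> real k \<le> (1 - x) / y \<and> (1 - x) / y < real k + 1"
      using xy by (simp add: pos_le_divide_eq pos_divide_less_eq)
    also have "\<dots> \<longleftrightarrow> \<lfloor>(1 - x) / y\<rfloor> = int k"
      by (simp add: floor_eq_iff)
    finally show ?thesis .
  qed
  have "0 \<le> \<lfloor>(1 - x) / y\<rfloor>" using xy by simp
  then have "\<lfloor>(1 - x) / y\<rfloor> = int (nat \<lfloor>(1 - x) / y\<rfloor>)" by simp
  then show ?thesis unfolding iff by (metis of_nat_eq_iff)
qed

lemma triangle_map_eq:
  assumes "(a, b) \<in> triangle_piece k"
  shows "triangle_map (a, b) = (b / a, (1 - a - real k * b) / a)"
proof -
  have "(a, b) \<in> triangle_domain" using assms by (auto simp: triangle_piece_def)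
  then have "(THE k. (a, b) \<in> triangle_piece k) = k"
    using assms triangle_piece_ex1 by (metis the1_equality)
  then show ?thesis by (simp add: triangle_map_def)
qed

lemma triangle_map_in:
  assumes "p \<in> triangle_domain"
  shows "triangle_map p \<in> triangle_domain \<union> {(t, 0) | t. 0 \<le> t \<and> t \<le> 1}"
proof -
  obtain a b where p: "p = (a, b)" by (cases p)
  obtain k where k: "(a, b) \<in> triangle_piece k"
    using triangle_piece_ex1[OF assms] p by blast
  then have ab: "a > 0" "b > 0" "b \<le> a" "1 - a - real k * b \<ge> 0" "1 - a - real k * b < b"
    by (auto simp: triangle_piece_def triangle_domain_def algebra_simps)
  define s t where "s = b / a" and "t = (1 - a - real k * b) / a"
  have st: "0 \<le> s" "s \<le> 1" "0 \<le> t" "t \<le> s"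
    using ab by (simp_all add: s_def t_def divide_right_mono)
  have "triangle_map p = (s, t)"
    unfolding p triangle_map_eq[OF k] by (simp add: s_def t_def)
  with st show ?thesis by (cases "t = 0") (auto simp: triangle_domain_def)
qed

end

(* Each branch of T maps its piece onto the whole triangle, up to boundary, with inverse
   (s, t) \<mapsto> (1/(1+ks+t), s/(1+ks+t)).  A rational point (a/d, b/d) is sent to
   (b/a, (d-a-kb)/a), so its denominators descend and its orbit reaches the bottom edge.
   Hence some iterate of any open U contains a one-sided neighbourhood of a point of the open
   bottom edge.  Such a neighbourhood meets all pieces of large index k, and their images
   together fill a neighbourhood of the corner (0, 0); one more step fills the
   open triangle, which then stays covered. *)
theory Submission
  imports Defs
begin

definition open_triangle :: "(real \<times> real) set" where
  "open_triangle = {(x, y). 0 < y \<and> y < x \<and> x < 1}"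

definition triangle_branch :: "nat \<Rightarrow> real \<times> real \<Rightarrow> real \<times> real" where
  "triangle_branch k q =
     (1 / (1 + real k * fst q + snd q), fst q / (1 + real k * fst q + snd q))"

text \<open>The open triangle is a sufficient target: it meets every nonempty relatively open subset
  of \<open>triangle_domain\<close>, and boundary points then stay out of the backward
  steps.\<close>

definition eventually_covers :: "(real \<times> real) set \<Rightarrow> bool" where
  "eventually_covers U \<longleftrightarrow> (\<exists>N. \<forall>n\<ge>N. open_triangle \<subseteq> triangle_iterate_image n U)"

section \<open>The open triangle and the inverse branches\<close>

lemma open_triangle_subset_domain: "open_triangle \<subseteq> triangle_domain"
  by (auto simp: open_triangle_def triangle_domain_def)

lemma open_open_triangle: "open open_triangle"
  unfolding open_triangle_def case_prod_unfold
  by (intro open_Collect_conj open_Collect_less continuous_intros)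

text \<open>With D = 1 + ks + t, the two expressions that cut out the piece become t / D and (t - s)
  / D, so their signs are exactly those given by 0 \<le> t < s.\<close>

lemma triangle_branch_in_piece:
  assumes "0 \<le> t" "t < s" "s \<le> 1"
  shows "triangle_branch k (s, t) \<in> triangle_piece k"
proof -
  define D where "D = 1 + real k * s + t"
  have D: "D \<ge> 1" using assms by (simp add: D_def)
  have 1: "1 - 1 / D - real k * (s / D) = t / D"
    using D by (simp add: field_simps) (simp add: D_def algebra_simps)
  have 2: "1 - 1 / D - real (k + 1) * (s / D) = (t - s) / D"
    using D by (simp add: field_simps) (simp add: D_def algebra_simps)
  have "(t - s) / D < 0" using D assms by (simp add: divide_neg_pos)
  moreover have "s / D \<le> 1 / D" using D assms by (simp add: divide_right_mono)
  moreover have "t / D \<ge> 0" using D assms by simp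
  then have "1 - 1 / D - real k * (s / D) \<ge> 0" by (simp only: 1)
  ultimately show ?thesis
    using D assms 2
    by (simp add: triangle_branch_def triangle_piece_def triangle_domain_def flip: D_def)
qed

lemma triangle_map_branch:
  assumes "0 \<le> t" "t < s" "s \<le> 1"
  shows "triangle_map (triangle_branch k (s, t)) = (s, t)"
proof -
  define D where "D = 1 + real k * s + t"
  have D: "D \<ge> 1" using assms by (simp add: D_def)
  have "(1 - 1 / D - real k * (s / D)) / (1 / D) = t"
    using D by (simp add: field_simps) (simp add: D_def algebra_simps)
  moreover have "(s / D) / (1 / D) = s" using D by simp
  moreover have "triangle_branch k (s, t) = (1 / D, s / D)"
    by (simp add: triangle_branch_def D_def)
  ultimately show ?thesis
    using triangle_map_eq triangle_branch_in_piece[OF assms, of k] by simp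
qed

section \<open>Pulling orbits back along branches\<close>

text \<open>Prepends one point to an orbit. The singleton image says both that q is the n-th iterate
  of the given point and that the orbit up to it is admissible.\<close>

lemma triangle_iterate_image_Suc:
  assumes "p \<in> U" "p \<in> triangle_domain"
    and "q \<in> triangle_iterate_image n {triangle_map p}"
  shows "q \<in> triangle_iterate_image (Suc n) U"
proof -
  have q: "q = (triangle_map ^^ Suc n) p"
    and *: "\<And>j. j < n \<Longrightarrow> (triangle_map ^^ Suc j) p \<in> triangle_domain"
    using assms(3) by (auto simp: triangle_iterate_image_def funpow_swap1)
  have "(triangle_map ^^ j) p \<in> triangle_domain" if "j < Suc n" for j
    using that * assms(2) by (cases j) auto
  with q assms(1) show ?thesis
    unfolding triangle_iterate_image_def by blast
qed

text \<open>If every point of W has a preimage in U, covering times grow by at most one. The index k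
  may vary with the point, so infinitely many branches can be used together.\<close>

lemma eventually_covers_step:
  assumes W: "\<And>s t. (s, t) \<in> W \<Longrightarrow> 0 < t \<and> t < s \<and> s < 1 \<and> (\<exists>k. triangle_branch k (s, t) \<in> U)"
    and "eventually_covers W"
  shows "eventually_covers U"
proof -
  obtain N where N: "\<And>n. n \<ge> N \<Longrightarrow> open_triangle \<subseteq> triangle_iterate_image n W"
    using assms(2) by (auto simp: eventually_covers_def)
  have sub: "triangle_iterate_image n W \<subseteq> triangle_iterate_image (Suc n) U" for n
  proof
    fix q assume "q \<in> triangle_iterate_image n W"
    then obtain s t where st: "(s, t) \<in> W" and q: "q \<in> triangle_iterate_image n {(s, t)}"
      by (auto simp: triangle_iterate_image_def)
    obtain k where k: "triangle_branch k (s, t) \<in> U" and *: "0 \<le> t" "t < s" "s \<le> 1"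
      using W[OF st] by auto
    have "triangle_branch k (s, t) \<in> triangle_domain"
      using triangle_branch_in_piece[OF *, of k] by (auto simp: triangle_piece_def)
    with k q show "q \<in> triangle_iterate_image (Suc n) U"
      using triangle_iterate_image_Suc triangle_map_branch[OF *] by metis
  qed
  have "open_triangle \<subseteq> triangle_iterate_image n U" if "n \<ge> Suc N" for n
    using that N[of "n - 1"] sub[of "n - 1"] by (cases n) auto
  then show ?thesis unfolding eventually_covers_def by blast
qed

lemma triangle_branch_in_open_triangle:
  assumes "0 < t" "t < s" "s < 1"
  shows "triangle_branch k (s, t) \<in> open_triangle"
proof -
  define D where "D = 1 + real k * s + t"
  have D: "D > 1" using assms by (simp add: D_def add_nonneg_pos)
  have "s / D < 1 / D" using D assms by (simp add: divide_strict_right_mono)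
  with D assms show ?thesis
    by (simp add: triangle_branch_def open_triangle_def flip: D_def)
qed

section \<open>Covering from the corner and from the bottom edge\<close>

text \<open>Branch 0 maps the open triangle into itself, so each of its points has backward orbits
  of every length that stay inside.\<close>

lemma eventually_covers_open_triangle: "eventually_covers open_triangle"
proof -
  have "open_triangle \<subseteq> triangle_iterate_image n open_triangle" for n
  proof (induction n)
    case 0
    show ?case by (auto simp: triangle_iterate_image_def)
  next
    case (Suc n)
    show ?case
    proof
      fix q assume "q \<in> open_triangle"
      with Suc obtain p where p: "p \<in> open_triangle" "q \<in> triangle_iterate_image n {p}"
        by (auto simp: triangle_iterate_image_def)
      obtain s t where st: "p = (s, t)" "0 < t" "t < s" "s < 1"
        using p by (auto simp: open_triangle_def)
      let ?r = "triangle_branch 0 (s, t)"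
      have "?r \<in> open_triangle" using st triangle_branch_in_open_triangle by blast
      moreover have "triangle_map ?r = p" using triangle_map_branch st by simp
      ultimately show "q \<in> triangle_iterate_image (Suc n) open_triangle"
        using triangle_iterate_image_Suc[of ?r open_triangle q n] p open_triangle_subset_domain
        by auto
    qed
  qed
  then show ?thesis unfolding eventually_covers_def by blast
qed

text \<open>For fixed (s, t) the first coordinate 1 / D of the k-th preimage tends to 0 as k grows,
  so every point of the open triangle has a preimage near the corner.\<close>

lemma eventually_covers_corner:
  assumes "\<delta> > 0"
  shows "eventually_covers {(x, y) \<in> open_triangle. x < \<delta>}"
proof (rule eventually_covers_step[OF _ eventually_covers_open_triangle])
  fix s t :: real assume "(s, t) \<in> open_triangle"
  then have st: "0 < t" "t < s" "s < 1" by (auto simp: open_triangle_def)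
  then obtain k :: nat where k: "1 / \<delta> < real k * s"
    using reals_Archimedean3[of s] by auto
  define D where "D = 1 + real k * s + t"
  have D: "1 / \<delta> < D" using st k by (simp add: D_def)
  moreover have "D > 0" using st by (simp add: D_def add_pos_nonneg)
  ultimately have "1 / D < \<delta>" using assms by (simp add: field_simps)
  then show "0 < t \<and> t < s \<and> s < 1 \<and> (\<exists>k. triangle_branch k (s, t) \<in> {(x, y) \<in> open_triangle. x < \<delta>})"
    using st triangle_branch_in_open_triangle[OF st, of k]
    by (auto simp: triangle_branch_def D_def intro!: exI[of _ k])
qed

text \<open>As k grows, D advances in steps of s. For (s, t) near the corner these steps are so
  short that some D falls just below 1 / c, which puts 1 / D close to c.\<close>

lemma eventually_covers_bottom_neighbourhood:
  assumes "0 < c" "c < 1" "\<epsilon> > 0"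
  shows "eventually_covers {(x, y) \<in> open_triangle. \<bar>x - c\<bar> < \<epsilon> \<and> y < \<epsilon>}" (is "eventually_covers ?W")
proof -
  \<comment> \<open>The first bound keeps the second coordinate s / D below \<epsilon>, the second
    makes 1 / c - 1 - t positive, the third turns D > 1 / c - \<delta> into 1 / D < c +
    \<epsilon>.\<close>
  define \<delta> where "\<delta> = min \<epsilon> (min (1 / c - 1) (1 / c - 1 / (c + \<epsilon>)))"
  have "1 / (c + \<epsilon>) < 1 / c" using assms by (simp add: frac_less2)
  then have \<delta>: "\<delta> > 0" using assms by (simp add: \<delta>_def)
  show ?thesis
  proof (rule eventually_covers_step[OF _ eventually_covers_corner[OF \<delta>]])
    fix s t :: real assume "(s, t) \<in> {(x, y) \<in> open_triangle. x < \<delta>}"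
    then have st: "0 < t" "t < s" "s < 1" "s < \<delta>" by (auto simp: open_triangle_def)
    \<comment> \<open>The largest k with D \<le> 1 / c; the floor is nonnegative, so
      \<open>nat\<close> loses nothing.\<close>
    define k where "k = nat \<lfloor>(1 / c - 1 - t) / s\<rfloor>"
    have "1 / c - 1 - t > 0" using st by (simp add: \<delta>_def)
    then have "(1 / c - 1 - t) / s \<ge> 0" using st by simp
    then have rk: "real k = of_int \<lfloor>(1 / c - 1 - t) / s\<rfloor>" by (simp add: k_def)
    have "real k \<le> (1 / c - 1 - t) / s" "(1 / c - 1 - t) / s < real k + 1"
      unfolding rk by linarith+
    then have k: "real k * s \<le> 1 / c - 1 - t" "1 / c - 1 - t < real k * s + s"
      using st by (simp_all add: field_simps)
    define D where "D = 1 + real k * s + t"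
    have D: "D \<le> 1 / c" "1 / c - \<delta> < D" using k st by (simp_all add: D_def)
    then have "1 / (c + \<epsilon>) < D" by (simp add: \<delta>_def)
    moreover have D1: "D \<ge> 1" using st by (simp add: D_def)
    ultimately have "1 / D < c + \<epsilon>" "c \<le> 1 / D"
      using D assms by (simp_all add: field_simps)
    moreover have "s / D \<le> s" using D1 st by (simp add: divide_le_eq)
    moreover have "s < \<epsilon>" using st by (simp add: \<delta>_def)
    ultimately have "triangle_branch k (s, t) \<in> ?W"
      using triangle_branch_in_open_triangle[of t s k] st assms
      by (auto simp: triangle_branch_def simp flip: D_def)
    then show "0 < t \<and> t < s \<and> s < 1 \<and> (\<exists>k. triangle_branch k (s, t) \<in> ?W)"
      using st by (intro conjI exI)
  qed
qed

section \<open>Descent along rational points\<close>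

lemma eventually_covers_mono:
  assumes "eventually_covers W" "W \<subseteq> U"
  shows "eventually_covers U"
proof -
  have "triangle_iterate_image n W \<subseteq> triangle_iterate_image n U" for n
    using assms(2) by (auto simp: triangle_iterate_image_def)
  with assms(1) show ?thesis unfolding eventually_covers_def by (meson subset_trans)
qed

lemma dist_pair_less:
  fixes x y :: real
  assumes "\<bar>x' - x\<bar> < e / 2" "\<bar>y' - y\<bar> < e / 2"
  shows "dist (x, y) (x', y') < e"
proof -
  have "dist (x, y) (x', y') \<le> \<bar>x - x'\<bar> + \<bar>y - y'\<bar>"
    unfolding dist_Pair_Pair dist_real_def power2_abs by (rule sqrt_sum_squares_le_sum_abs)
  with assms show ?thesis by linarith
qed

text \<open>The region reaches below the bottom edge, so that points (c, 0) are interior to it; the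
  denominator of the branch is still positive there.\<close>

lemma open_triangle_branch_preimage:
  assumes "open U"
  shows "open ({q. 0 < fst q \<and> -1 < snd q} \<inter> triangle_branch k -` U)"
proof (rule continuous_open_preimage[OF _ _ assms])
  have ne: "1 + real k * s + t \<noteq> 0" if "0 < s" "-1 < t" for s t
    using that mult_nonneg_nonneg[of "real k" s] by linarith
  show "continuous_on {q. 0 < fst q \<and> -1 < snd q} (triangle_branch k)"
    unfolding triangle_branch_def by (intro continuous_intros) (auto dest: ne)
  show "open {q :: real \<times> real. 0 < fst q \<and> -1 < snd q}"
    by (intro open_Collect_conj open_Collect_less continuous_intros)
qed

text \<open>A Euclidean descent: T sends (a/d, b/d) to (b/a, r/a) with r < d, so the sum of the
  three integers drops until r = 0. The open set is replaced by a branch preimage at each step,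
  hence U is generalized.\<close>

lemma eventually_covers_rational:
  fixes a b d :: nat
  assumes "open U" "0 < b" "b < a" "a < d" "(real a / real d, real b / real d) \<in> U"
  shows "eventually_covers U"
  using assms
proof (induction "a + b + d" arbitrary: a b d U rule: less_induct)
  case less
  \<comment> \<open>The index of the piece containing (a/d, b/d); the remainder r is the new second
    numerator.\<close>
  define k where "k = (d - a) div b"
  define r where "r = (d - a) mod b"
  have rb: "r < b" using less.prems by (simp add: r_def)
  have "k * b + r = d - a" by (simp add: k_def r_def)
  then have d: "d = a + k * b + r" using less.prems by linarith
  define G where "G = {q. 0 < fst q \<and> -1 < snd q} \<inter> triangle_branch k -` U"
  have G: "open G" unfolding G_def by (rule open_triangle_branch_preimage[OF less.prems(1)])
  have "1 + real k * (real b / real a) + real r / real a = real d / real a"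
    using less.prems by (simp add: d field_simps)
  then have "triangle_branch k (real b / real a, real r / real a) = (real a / real d, real b / real d)"
    using less.prems by (simp add: triangle_branch_def)
  then have inG: "(real b / real a, real r / real a) \<in> G"
    using less.prems by (simp add: G_def) (smt (verit) divide_nonneg_nonneg of_nat_0_le_iff)
  have "eventually_covers (G \<inter> open_triangle)"
  proof (cases "r = 0")
    case False
    have "open (G \<inter> open_triangle)" using G open_open_triangle by blast
    moreover have "(real b / real a, real r / real a) \<in> G \<inter> open_triangle"
      using inG less.prems rb False by (simp add: open_triangle_def divide_strict_right_mono)
    moreover have "b + r + a < a + b + d" using d less.prems by auto
    ultimately show ?thesis using less.hyps[of b r a] False rb less.prems by auto
  next
    \<comment> \<open>The image (c, 0) lies on the bottom edge, outside the open triangle, so the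
      part of a neighbourhood above the edge takes its place.\<close>
    case True
    define c where "c = real b / real a"
    have c: "0 < c" "c < 1" using less.prems by (simp_all add: c_def)
    have "(c, 0) \<in> G" using inG True by (simp add: c_def)
    then obtain e where e: "e > 0" "ball (c, 0) e \<subseteq> G" using G open_contains_ball by blast
    have "{(x, y) \<in> open_triangle. \<bar>x - c\<bar> < e / 2 \<and> y < e / 2} \<subseteq> G \<inter> open_triangle"
    proof
      fix q assume "q \<in> {(x, y) \<in> open_triangle. \<bar>x - c\<bar> < e / 2 \<and> y < e / 2}"
      then obtain x y where *: "q = (x, y)" "(x, y) \<in> open_triangle" "\<bar>x - c\<bar> < e / 2" "y < e / 2"
        by auto
      then have "dist (c, 0) (x, y) < e"
        by (intro dist_pair_less) (auto simp: open_triangle_def)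
      with * e show "q \<in> G \<inter> open_triangle" by auto
    qed
    with eventually_covers_bottom_neighbourhood[OF c, of "e / 2"] e(1) show ?thesis
      using eventually_covers_mono by simp
  qed
  then show ?case
    by (rule eventually_covers_step[where W = "G \<inter> open_triangle", rotated])
      (auto simp: G_def open_triangle_def)
qed

text \<open>Moving p slightly left and down, with the second coordinate kept below the first, leaves
  the sides x = 1 and x = y that p may lie on.\<close>

lemma rational_point_in_open_set:
  assumes "open S" "p \<in> S" "p \<in> triangle_domain"
  obtains a b d :: nat where "0 < b" "b < a" "a < d" "(real a / real d, real b / real d) \<in> S"
proof -
  obtain x y where p: "p = (x, y)" by (cases p)
  have xy: "x \<le> 1" "y \<le> x" "0 < y" using assms(3) by (auto simp: p triangle_domain_def)
  obtain e where e: "e > 0" "ball (x, y) e \<subseteq> S"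
    using assms(1,2) p open_contains_ball by blast
  obtain x' where x': "x' \<in> \<rat>" "max 0 (x - e / 2) < x'" "x' < x"
    using Rats_dense_in_real[of "max 0 (x - e / 2)" x] xy e by auto
  obtain y' where y': "y' \<in> \<rat>" "max 0 (y - e / 2) < y'" "y' < min y x'"
    using Rats_dense_in_real[of "max 0 (y - e / 2)" "min y x'"] xy x' e by auto
  have "dist (x, y) (x', y') < e" using x' y' by (intro dist_pair_less) auto
  then have S: "(x', y') \<in> S" using e by auto
  obtain m n where mn: "n \<noteq> 0" "\<bar>x'\<bar> = real m / real n"
    using Rats_abs_nat_div_natE[OF x'(1)] by metis
  obtain i j where ij: "j \<noteq> 0" "\<bar>y'\<bar> = real i / real j"
    using Rats_abs_nat_div_natE[OF y'(1)] by metis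
  \<comment> \<open>Brings m/n and i/j to a common denominator.\<close>
  define a b d where "a = m * j" and "b = i * n" and "d = n * j"
  have d: "d > 0" using mn ij by (simp add: d_def)
  have eq: "x' = real a / real d" "y' = real b / real d"
    using x' y' mn ij by (simp_all add: a_def b_def d_def)
  have "0 < real b / real d" "real b / real d < real a / real d" "real a / real d < 1"
    using x' y' xy by (simp_all flip: eq)
  then have "0 < b" "b < a" "a < d" using d by (simp_all add: divide_less_cancel zero_less_divide_iff)
  with that S eq show thesis by metis
qed

theorem theorem22:
  fixes U V :: "(real \<times> real) set"
  assumes "openin (top_of_set triangle_domain) U" and "U \<noteq> {}"
    and "openin (top_of_set triangle_domain) V" and "V \<noteq> {}"
  shows "\<exists>N::nat. N > 0 \<and> (\<forall>k\<ge>N. triangle_iterate_image k U \<inter> V \<noteq> {})"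
proof -
  obtain S where S: "open S" "U = triangle_domain \<inter> S" using assms(1) openin_open by metis
  obtain R where R: "open R" "V = triangle_domain \<inter> R" using assms(3) openin_open by metis
  obtain p where p: "p \<in> S" "p \<in> triangle_domain" using S(2) assms(2) by blast
  obtain a b d :: nat where r: "0 < b" "b < a" "a < d" "(real a / real d, real b / real d) \<in> S"
    by (rule rational_point_in_open_set[OF S(1) p])
  have "open (S \<inter> open_triangle)" using S open_open_triangle by blast
  moreover have "(real a / real d, real b / real d) \<in> open_triangle"
    using r by (simp add: open_triangle_def divide_strict_right_mono)
  ultimately have "eventually_covers (S \<inter> open_triangle)"
    using eventually_covers_rational r by simp
  then have "eventually_covers U"
    by (rule eventually_covers_mono) (use S open_triangle_subset_domain in auto)
  then obtain N where N: "\<And>n. n \<ge> N \<Longrightarrow> open_triangle \<subseteq> triangle_iterate_image n U"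
    by (auto simp: eventually_covers_def)
  \<comment> \<open>The rational point serves here only to show that V meets the open
    triangle.\<close>
  obtain p' where p': "p' \<in> R" "p' \<in> triangle_domain" using R(2) assms(4) by blast
  obtain a' b' d' :: nat where r': "0 < b'" "b' < a'" "a' < d'"
    "(real a' / real d', real b' / real d') \<in> R"
    by (rule rational_point_in_open_set[OF R(1) p'])
  from r'(1-3) have "(real a' / real d', real b' / real d') \<in> open_triangle"
    by (simp add: open_triangle_def divide_strict_right_mono)
  with r' have "(real a' / real d', real b' / real d') \<in> open_triangle \<inter> V"
    using R open_triangle_subset_domain by auto
  then have "\<forall>k\<ge>Suc N. triangle_iterate_image k U \<inter> V \<noteq> {}"
    using N Suc_leD by blast
  then show ?thesis by (intro exI[of _ "Suc N"]) simp
qed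

end
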